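(* Let $(K,v,\sigma)$ be a multiplicative valued difference field of characteristic zero that is spherically complete, whose difference residue field $(\mathbf{k},\bar\sigma)$ is an ACFA of characteristic zero, whose scaling exponent $\rho>0$ is transcendental over $\mathbb{Q}$, whose difference value group $\Gamma$ is a subgroup of $\mathbb{R}$ that is a $\mathbb{Q}(\rho)$-module, and whose valuation has a splitting $\gamma\mapsto t^\gamma$ compatible with $\sigma$. If $f=\sum_{u(\sigma)}c_{u(\sigma)}x^{u(\sigma)}\in K_\sigma[x_1^{\pm1},\dots,x_n^{\pm1}]$ is a Laurent difference polynomial, then its associated difference tropical hypersurface $\mathrm{trop}(V(f))\subseteq\mathbb{R}^n$ is the support of a pure $(\Gamma,\mathbb{Q}(\rho))$-polyhedral complex of dimension $n-1$. More precisely, it is the $(n-1)$-skeleton of the polyhedral complex $\Sigma_{val}^{\circ}$ dual to the regular subdivision $\Sigma_{val}$ of $P$, where $P$ is the Newton polytope of $f$ and $val$ is the weight vector given by $v(c_{u(\sigma)})$ for $c_{u(\sigma)}\ne 0$.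
   Context: Difference algebra. A difference field is a field with a field automorphism $\sigma$. An ACFA is a difference field $(k,\sigma)$ such that every finite system of difference polynomial equations over $k$ with a solution in some difference field extension of $k$ has a solution in $k$. A valued difference field is a valued field $K$ with an automorphism $\sigma$ preserving the valuation ring, $\sigma(\mathcal{O}_K)=\mathcal{O}_K$; the residue field $\mathbf{k}$ carries the induced automorphism $\bar\sigma(\bar a)=\overline{\sigma(a)}$, and the value group $\Gamma$ the induced automorphism $v(a)\mapsto v(\sigma(a))$. $K$ is multiplicative with scaling exponent $\rho>0$ if $v(\sigma(x))=\rho\, v(x)$ for all $x\in K^\times$. Spherically complete: every chain of balls has nonempty intersection. A splitting compatible with $\sigma$ is a group homomorphism $\Gamma\to K^\times$, $\gamma\mapsto t^\gamma$, with $v(t^\gamma)=\gamma$, $\sigma(t^\gamma)=t^{\rho\gamma}$. $K_\sigma[x_1^{\pm1},\dots,x_n^{\pm1}]$ is the Laurent polynomial ring over $K$ in the formal variables $\sigma^j(x_i)$, $j\ge0$, $1\le i\le n$. For $u(\sigma)\in(\mathbb{Z}[\sigma])^n$, $u_i(\sigma)=\sum_j a_{i,j}\sigma^j$, write $x^{u(\sigma)}=\prod_{i,j}\sigma^j(x_i)^{a_{i,j}}$ and $u(\rho)=(\sum_j a_{i,j}\rho^j)_i\in\mathbb{R}^n$; $f$ is a finite sum of terms $c_{u(\sigma)}x^{u(\sigma)}$. $\mathrm{trop}(V(f))$ is the set of $w\in\mathbb{R}^n$ such that the minimum of $v(c_{u(\sigma)})+u(\rho)\cdot w$ over the exponents $u(\sigma)$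 appearing in $f$ is attained at least twice. Polyhedral geometry. A polyhedron is $\{x\in\mathbb{R}^n: \mathcal{A}x\le\mathcal{B}\}$ with $\mathcal{A}\in M_{d\times n}(\mathbb{R})$, $\mathcal{B}\in\mathbb{R}^d$; it is a $(\Gamma,\mathbb{Q}(\rho))$-polyhedron if $\mathcal{A}\in M_{d\times n}(\mathbb{Q}(\rho))$ and $\mathcal{B}\in\Gamma^d$. For a linear functional $v$, $\mathrm{face}_v(P)=\{x\in P: v\cdot x\le v\cdot y\ \forall y\in P\}$; the faces of $P$ are these sets and $\emptyset$ (of dimension $-1$). A polyhedral complex is a finite collection of polyhedra (cells) closed under taking faces and such that the intersection of any two is a face of both. A facet of a complex is a cell that is not a face of another cell of higher dimension; the dimension of a complex is the maximal dimension of its cells, and it is pure if all its facets have the same dimension. The support of a complex is the union of its cells; its $k$-skeleton is the complex consisting of all cells of dimension at most $k$. A $(\Gamma,\mathbb{Q}(\rho))$-polyhedral complex is one all of whose cells are $(\Gamma,\mathbb{Q}(\rho))$-polyhedra. The Newton polytope of $f$ is $P=\mathrm{conv}\{u(\rho): c_{u(\sigma)}\ne0\}\subseteq\mathbb{R}^n$. Put $P_{val}=\mathrm{conv}\{(u(\rho),v(c_{u(\sigma)})): c_{u(\sigma)}\neq0\}\subseteq\mathbb{R}^{n+1}$. A lower face of $P_{val}$ is a face of the form $\mathrm{face}_v(P_{val})$ with $v\in\mathbb{R}^{n+1}$ having positive last coordinate. With $\pi:\mathbb{R}^{n+1}\to\mathbb{R}^n$ the projection to the first $n$ coordinates, the regular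 subdivision is $\Sigma_{val}=\{\pi(F): F\text{ a lower face of }P_{val}\}$ (with support $P$). The normal fan of $P_{val}$ is the polyhedral complex consisting of the closed normal cones $\{v : \mathrm{face}_v(P_{val})\supseteq F\}$, for $F$ a face of $P_{val}$. The dual complex $\Sigma_{val}^{\circ}$ is the complex in $\mathbb{R}^n$ obtained by intersecting this normal fan with the hyperplane where the last coordinate equals $1$ (and dropping that coordinate): to each lower face $F$ of $P_{val}$ corresponds the cell $\{w\in\mathbb{R}^n : \mathrm{face}_{(w,1)}(P_{val})\supseteq F\}$.
   Formalization: The dimension n-1 is claimed only when f has at least two terms (for a monomial or f=0 the tropical hypersurface is empty and the claim fails), and the empty cell is exempt from being a (Γ,Q(ρ))-polyhedron (impossible if Γ=0). *)

theory Defs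
  imports
    "HOL-Analysis.Analysis"
    "HOL-Algebra.Algebra"
    "HOL-Algebra.Algebraic_Closure_Type"
    "HOL-Computational_Algebra.Polynomial"
    "HOL-Library.Poly_Mapping"
begin

section \<open>Difference fields\<close>

definition difference_field :: "'a ring \<Rightarrow> ('a \<Rightarrow> 'a) \<Rightarrow> bool" where
  "difference_field k \<sigma> \<longleftrightarrow> field k \<and> \<sigma> \<in> ring_iso k k"

definition ring_char_zero :: "'a ring \<Rightarrow> bool" where
  "ring_char_zero R \<longleftrightarrow> (\<forall>n::nat. n > 0 \<longrightarrow> add_pow R n \<one>\<^bsub>R\<^esub> \<noteq> \<zero>\<^bsub>R\<^esub>)"

text \<open>The embedding \<open>h\<close> of \<open>k\<close> into \<open>L\<close> is automatically injective, \<open>k\<close> and \<open>L\<close> being fields.\<close>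

definition difference_extension ::
    "'a ring \<Rightarrow> ('a \<Rightarrow> 'a) \<Rightarrow> 'b ring \<Rightarrow> ('b \<Rightarrow> 'b) \<Rightarrow> ('a \<Rightarrow> 'b) \<Rightarrow> bool" where
  "difference_extension k \<sigma> L \<tau> h \<longleftrightarrow>
     difference_field L \<tau> \<and> h \<in> ring_hom k L \<and> (\<forall>x\<in>carrier k. h (\<sigma> x) = \<tau> (h x))"

text \<open>Difference polynomials over \<open>k\<close> in \<open>m\<close> unknowns: the letter \<open>(i, j)\<close> stands for
  \<open>\<sigma>\<^sup>j(y\<^sub>i)\<close>.\<close>

definition difference_polys :: "'a ring \<Rightarrow> nat \<Rightarrow> ((nat \<times> nat) multiset \<Rightarrow> 'a) set" where
  "difference_polys k m = ring.indexed_pset k ({..<m} \<times> UNIV) (carrier k)"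

definition difference_eval ::
    "'a ring \<Rightarrow> 'b ring \<Rightarrow> ('b \<Rightarrow> 'b) \<Rightarrow> ('a \<Rightarrow> 'b) \<Rightarrow> (nat \<Rightarrow> 'b) \<Rightarrow> ((nat \<times> nat) multiset \<Rightarrow> 'a) \<Rightarrow> 'b"
  where
  "difference_eval k L \<tau> h a p =
     (\<Oplus>\<^bsub>L\<^esub>M\<in>{M. p M \<noteq> \<zero>\<^bsub>k\<^esub>}.
        h (p M) \<otimes>\<^bsub>L\<^esub> (\<Otimes>\<^bsub>L\<^esub>x\<in>set_mset M. (\<tau> ^^ snd x) (a (fst x)) [^]\<^bsub>L\<^esub> count M x))"

definition difference_solvable ::
    "'a ring \<Rightarrow> 'b ring \<Rightarrow> ('b \<Rightarrow> 'b) \<Rightarrow> ('a \<Rightarrow> 'b) \<Rightarrow> nat \<Rightarrow> ((nat \<times> nat) multiset \<Rightarrow> 'a) set \<Rightarrow> bool"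
  where
  "difference_solvable k L \<tau> h m S \<longleftrightarrow>
     (\<exists>a. (\<forall>i<m. a i \<in> carrier L) \<and> (\<forall>p\<in>S. difference_eval k L \<tau> h a p = \<zero>\<^bsub>L\<^esub>))"

text \<open>The extensions range over difference fields carried by subsets of \<^typ>\<open>'a + nat\<close>.
  This is no restriction: if a finite system has a solution in some extension \<open>L\<close>, it has
  one in the difference subfield of \<open>L\<close> generated by (the image of) \<open>k\<close> and the
  coordinates of that solution, whose cardinality is at most the maximum of those of \<open>k\<close> and
  \<^typ>\<open>nat\<close>, and which therefore has an isomorphic copy inside \<^typ>\<open>'a + nat\<close>.\<close>

definition ACFA :: "'a ring \<Rightarrow> ('a \<Rightarrow> 'a) \<Rightarrow> bool" where
  "ACFA k \<sigma> \<longleftrightarrow> difference_field k \<sigma> \<and>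
     (\<forall>m S. finite S \<and> S \<subseteq> difference_polys k m \<longrightarrow>
        (\<exists>(L :: ('a + nat) ring) \<tau> h.
            difference_extension k \<sigma> L \<tau> h \<and> difference_solvable k L \<tau> h m S) \<longrightarrow>
        difference_solvable k k \<sigma> (\<lambda>x. x) m S)"


section \<open>Valued difference fields\<close>

text \<open>Only the values of \<open>v\<close> on nonzero elements are meaningful; \<open>v 0\<close>, which ought to be
  infinite, is an arbitrary real number.\<close>

definition valuation :: "('k::field \<Rightarrow> real) \<Rightarrow> bool" where
  "valuation v \<longleftrightarrow>
     (\<forall>x y. x \<noteq> 0 \<longrightarrow> y \<noteq> 0 \<longrightarrow> v (x * y) = v x + v y) \<and>
     (\<forall>x y. x \<noteq> 0 \<longrightarrow> y \<noteq> 0 \<longrightarrow> x + y \<noteq> 0 \<longrightarrow> min (v x) (v y) \<le> v (x + y))"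

definition value_group :: "('k::field \<Rightarrow> real) \<Rightarrow> real set" where
  "value_group v = v ` (UNIV - {0})"

definition valuation_ring :: "('k::field \<Rightarrow> real) \<Rightarrow> 'k ring" where
  "valuation_ring v = ring_of_type_algebra\<lparr>carrier := {x. x = 0 \<or> 0 \<le> v x}\<rparr>"

definition valuation_ideal :: "('k::field \<Rightarrow> real) \<Rightarrow> 'k set" where
  "valuation_ideal v = {x. x = 0 \<or> 0 < v x}"

definition residue_field :: "('k::field \<Rightarrow> real) \<Rightarrow> 'k set ring" where
  "residue_field v = valuation_ring v Quot valuation_ideal v"

text \<open>Elements of the residue field are cosets of the maximal ideal, and the image under \<open>\<sigma>\<close> of
  the coset of \<open>a\<close> is the coset of \<open>\<sigma> a\<close>.\<close>

definition residue_automorphism :: "('k \<Rightarrow> 'k) \<Rightarrow> 'k set \<Rightarrow> 'k set" where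
  "residue_automorphism \<sigma> A = \<sigma> ` A"

definition valued_difference_field :: "('k::field \<Rightarrow> real) \<Rightarrow> ('k \<Rightarrow> 'k) \<Rightarrow> bool" where
  "valued_difference_field v \<sigma> \<longleftrightarrow>
     valuation v \<and> difference_field ring_of_type_algebra \<sigma> \<and>
     \<sigma> ` carrier (valuation_ring v) = carrier (valuation_ring v)"

definition multiplicative_scaling ::
    "('k::field \<Rightarrow> real) \<Rightarrow> ('k \<Rightarrow> 'k) \<Rightarrow> real \<Rightarrow> bool" where
  "multiplicative_scaling v \<sigma> \<rho> \<longleftrightarrow> 0 < \<rho> \<and> (\<forall>x. x \<noteq> 0 \<longrightarrow> v (\<sigma> x) = \<rho> * v x)"

definition valuation_balls :: "('k::field \<Rightarrow> real) \<Rightarrow> 'k set set" where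
  "valuation_balls v =
     {{x. x = a \<or> \<gamma> \<le> v (x - a)} | a \<gamma>. \<gamma> \<in> value_group v} \<union>
     {{x. x = a \<or> \<gamma> < v (x - a)} | a \<gamma>. \<gamma> \<in> value_group v}"

definition spherically_complete :: "('k::field \<Rightarrow> real) \<Rightarrow> bool" where
  "spherically_complete v \<longleftrightarrow> (\<forall>C. subset.chain (valuation_balls v) C \<longrightarrow> \<Inter>C \<noteq> {})"

definition Q_adjoin :: "real \<Rightarrow> real set" where
  "Q_adjoin \<rho> = generate_field ring_of_type_algebra {\<rho>}"

definition real_submodule :: "real set \<Rightarrow> real set \<Rightarrow> bool" where
  "real_submodule R G \<longleftrightarrow>
     0 \<in> G \<and> (\<forall>x\<in>G. \<forall>y\<in>G. x - y \<in> G) \<and> (\<forall>r\<in>R. \<forall>x\<in>G. r * x \<in> G)"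

definition compatible_splitting ::
    "('k::field \<Rightarrow> real) \<Rightarrow> ('k \<Rightarrow> 'k) \<Rightarrow> real \<Rightarrow> (real \<Rightarrow> 'k) \<Rightarrow> bool" where
  "compatible_splitting v \<sigma> \<rho> t \<longleftrightarrow>
     (\<forall>\<gamma>\<in>value_group v. \<forall>\<delta>\<in>value_group v. t (\<gamma> + \<delta>) = t \<gamma> * t \<delta>) \<and>
     (\<forall>\<gamma>\<in>value_group v. t \<gamma> \<noteq> 0 \<and> v (t \<gamma>) = \<gamma> \<and> \<sigma> (t \<gamma>) = t (\<rho> * \<gamma>))"


section \<open>Polyhedral geometry\<close>

definition min_face :: "'a::real_inner \<Rightarrow> 'a set \<Rightarrow> 'a set" where
  "min_face c P = {x \<in> P. \<forall>y\<in>P. c \<bullet> x \<le> c \<bullet> y}"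

definition is_face :: "'a::real_inner set \<Rightarrow> 'a set \<Rightarrow> bool" where
  "is_face F P \<longleftrightarrow> F = {} \<or> (\<exists>c. F = min_face c P)"

lemma is_face_iff_exposed_face_of:
  fixes P :: "'a::euclidean_space set"
  assumes "convex P"
  shows "is_face F P \<longleftrightarrow> F exposed_face_of P"
proof
  assume "is_face F P"
  then consider "F = {}" | c where "F = min_face c P" "F \<noteq> {}"
    unfolding is_face_def by blast
  then show "F exposed_face_of P"
  proof cases
    case 1
    then show ?thesis by simp
  next
    case 2
    then obtain x where x: "x \<in> P" "\<And>y. y \<in> P \<Longrightarrow> c \<bullet> x \<le> c \<bullet> y"
      unfolding min_face_def by blast
    have "F = P \<inter> {y. (- c) \<bullet> y = (- c) \<bullet> x}"
      unfolding 2 min_face_def using x by (auto intro: antisym)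
    with x show ?thesis
      using exposed_face_of_Int_supporting_hyperplane_le[OF assms, of "- c" "(- c) \<bullet> x"] by simp
  qed
next
  assume "F exposed_face_of P"
  then obtain a b where ab: "P \<subseteq> {x. a \<bullet> x \<le> b}" "F = P \<inter> {x. a \<bullet> x = b}"
    unfolding exposed_face_of_def by blast
  show "is_face F P"
  proof (cases "F = {}")
    case False
    then obtain z where "z \<in> P" "a \<bullet> z = b" using ab by blast
    then have "F = min_face (- a) P"
      unfolding ab min_face_def using ab(1) by (auto intro: antisym)
    then show ?thesis unfolding is_face_def by blast
  qed (simp add: is_face_def)
qed

lemma is_face_iff_face_of:
  fixes P :: "'a::euclidean_space set"
  assumes "polyhedron P"
  shows "is_face F P \<longleftrightarrow> F face_of P"
  using is_face_iff_exposed_face_of[OF polyhedron_imp_convex[OF assms]]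
    exposed_face_of_polyhedron[OF assms] by simp

definition polyhedral_complex :: "'a::euclidean_space set set \<Rightarrow> bool" where
  "polyhedral_complex \<C> \<longleftrightarrow>
     finite \<C> \<and> (\<forall>C\<in>\<C>. polyhedron C) \<and>
     (\<forall>C\<in>\<C>. \<forall>F. is_face F C \<longrightarrow> F \<in> \<C>) \<and>
     (\<forall>C\<in>\<C>. \<forall>D\<in>\<C>. is_face (C \<inter> D) C \<and> is_face (C \<inter> D) D)"

definition complex_facet :: "'a::euclidean_space set \<Rightarrow> 'a set set \<Rightarrow> bool" where
  "complex_facet C \<C> \<longleftrightarrow> C \<in> \<C> \<and> \<not> (\<exists>D\<in>\<C>. is_face C D \<and> aff_dim C < aff_dim D)"

definition pure_complex :: "'a::euclidean_space set set \<Rightarrow> bool" where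
  "pure_complex \<C> \<longleftrightarrow>
     (\<forall>C D. complex_facet C \<C> \<longrightarrow> complex_facet D \<C> \<longrightarrow> aff_dim C = aff_dim D)"

definition complex_dim :: "'a::euclidean_space set set \<Rightarrow> int" where
  "complex_dim \<C> = Max (aff_dim ` \<C>)"

definition skeleton :: "int \<Rightarrow> 'a::euclidean_space set set \<Rightarrow> 'a set set" where
  "skeleton d \<C> = {C \<in> \<C>. aff_dim C \<le> d}"

definition rational_polyhedron :: "real set \<Rightarrow> real set \<Rightarrow> (real^'n) set \<Rightarrow> bool" where
  "rational_polyhedron G Q P \<longleftrightarrow>
     (\<exists>(d::nat) (A :: nat \<Rightarrow> real^'n) (B :: nat \<Rightarrow> real).
        (\<forall>i<d. B i \<in> G \<and> (\<forall>j. A i $ j \<in> Q)) \<and> P = {x. \<forall>i<d. A i \<bullet> x \<le> B i})"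

text \<open>Every complex with a nonempty set of cells contains the empty cell, which is exempted from
  the rationality condition. The exemption matters only for \<open>G = {0}\<close>, where every
  \<open>{x. A x \<le> 0}\<close> contains the origin; for nontrivial \<open>G\<close> (a group) the empty set is
  \<open>{x. 0 \<bullet> x \<le> b}\<close> with \<open>b < 0\<close> in \<open>G\<close>.\<close>

definition rational_polyhedral_complex :: "real set \<Rightarrow> real set \<Rightarrow> (real^'n) set set \<Rightarrow> bool" where
  "rational_polyhedral_complex G Q \<C> \<longleftrightarrow>
     polyhedral_complex \<C> \<and> (\<forall>C\<in>\<C>. C \<noteq> {} \<longrightarrow> rational_polyhedron G Q C)"

text \<open>The normal cone of the empty face would be the whole space, which does not fit into a
  complex; instead the empty cone is added, as the common face of all cones.\<close>

definition normal_cone :: "'a::real_inner set \<Rightarrow> 'a set \<Rightarrow> 'a set" where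
  "normal_cone P F = {c. F \<subseteq> min_face c P}"

definition normal_fan :: "'a::real_inner set \<Rightarrow> 'a set set" where
  "normal_fan P = insert {} {normal_cone P F | F. is_face F P \<and> F \<noteq> {}}"

definition lower_faces :: "('a::real_inner \<times> real) set \<Rightarrow> ('a \<times> real) set set" where
  "lower_faces P = {min_face c P | c. 0 < snd c}"

definition regular_subdivision :: "('a::real_inner \<times> real) set \<Rightarrow> 'a set set" where
  "regular_subdivision P = (\<lambda>F. fst ` F) ` lower_faces P"

definition dual_complex :: "('a::real_inner \<times> real) set \<Rightarrow> 'a set set" where
  "dual_complex P = (\<lambda>N. {w. (w, 1) \<in> N}) ` normal_fan P"

definition dual_cell :: "('a::real_inner \<times> real) set \<Rightarrow> ('a \<times> real) set \<Rightarrow> 'a set" where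
  "dual_cell P F = {w. F \<subseteq> min_face (w, 1) P}"

lemma dual_complex_eq_dual_cells:
  "dual_complex P = insert {} (dual_cell P ` (lower_faces P - {{}}))"
proof -
  have cell: "{w. (w, 1) \<in> normal_cone P F} = dual_cell P F" for F
    by (simp add: normal_cone_def dual_cell_def)
  have lower: "F \<in> lower_faces P"
    if F: "is_face F P" "F \<noteq> {}" and w: "w \<in> dual_cell P F" for F w
  proof -
    from F obtain c where c: "F = min_face c P" unfolding is_face_def by blast
    from F obtain z where z: "z \<in> F" by blast
    define s where "s = \<bar>snd c\<bar> + 1"
    define c' where "c' = c + s *\<^sub>R (w, 1)"
    have s: "s > 0" "snd c' > 0" unfolding s_def c'_def by auto
    have cz: "z \<in> P" "\<And>y. y \<in> P \<Longrightarrow> c \<bullet> z \<le> c \<bullet> y"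
      using z c by (auto simp: min_face_def)
    have wF: "\<And>x y. x \<in> F \<Longrightarrow> y \<in> P \<Longrightarrow> (w, 1) \<bullet> x \<le> (w, 1) \<bullet> y"
      using w unfolding dual_cell_def min_face_def by blast
    have exp: "c' \<bullet> x = c \<bullet> x + s * ((w, 1) \<bullet> x)" for x
      unfolding c'_def by (simp add: inner_add_left inner_prod_def algebra_simps)
    have "F = min_face c' P"
    proof (intro equalityI subsetI)
      fix x assume x: "x \<in> F"
      have "c' \<bullet> x \<le> c' \<bullet> y" if "y \<in> P" for y
        unfolding exp using x c that wF[OF x that] s
        by (intro add_mono mult_left_mono) (auto simp: min_face_def)
      with x c show "x \<in> min_face c' P" by (auto simp: min_face_def)
    next
      fix x assume "x \<in> min_face c' P"
      then have x: "x \<in> P" "c' \<bullet> x \<le> c' \<bullet> z" using cz by (auto simp: min_face_def)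
      have "s * ((w, 1) \<bullet> z) \<le> s * ((w, 1) \<bullet> x)"
        using wF[OF z x(1)] s by (intro mult_left_mono) auto
      with x(2) have "c \<bullet> x \<le> c \<bullet> z" unfolding exp by linarith
      then have "\<forall>y\<in>P. c \<bullet> x \<le> c \<bullet> y" using cz(2) by (meson order_trans)
      with x(1) show "x \<in> F" unfolding c min_face_def by blast
    qed
    with s show ?thesis unfolding lower_faces_def by blast
  qed
  show ?thesis
  proof (intro equalityI subsetI)
    fix D assume "D \<in> dual_complex P"
    then consider "D = {}" | F where "is_face F P" "F \<noteq> {}" "D = dual_cell P F" "D \<noteq> {}"
      unfolding dual_complex_def normal_fan_def using cell by fastforce
    then show "D \<in> insert {} (dual_cell P ` (lower_faces P - {{}}))"
      by cases (use lower in auto)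
  next
    fix D assume "D \<in> insert {} (dual_cell P ` (lower_faces P - {{}}))"
    then consider "D = {}" | F where "F \<in> lower_faces P" "F \<noteq> {}" "D = dual_cell P F"
      by blast
    then show "D \<in> dual_complex P"
    proof cases
      case 1
      then show ?thesis unfolding dual_complex_def normal_fan_def by auto
    next
      case 2
      then have "is_face F P" unfolding lower_faces_def is_face_def by blast
      with 2 cell[of F] show ?thesis unfolding dual_complex_def normal_fan_def by blast
    qed
  qed
qed

text \<open>Duality between a complex \<open>D\<close> and the regular subdivision obtained by projecting the lower
  faces of \<open>P\<close>: an inclusion-reversing bijection between the nonempty cells, matching the
  projection of a lower face \<open>F\<close> with the dual cell of \<open>F\<close>.\<close>

definition dual_to_regular_subdivision ::
    "'a::real_inner set set \<Rightarrow> ('a \<times> real) set \<Rightarrow> bool" where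
  "dual_to_regular_subdivision D P \<longleftrightarrow>
     (\<exists>\<delta>. bij_betw \<delta> (regular_subdivision P - {{}}) (D - {{}}) \<and>
        (\<forall>F\<in>lower_faces P. F \<noteq> {} \<longrightarrow> \<delta> (fst ` F) = dual_cell P F) \<and>
        (\<forall>G\<in>regular_subdivision P - {{}}. \<forall>H\<in>regular_subdivision P - {{}}.
           G \<subseteq> H \<longleftrightarrow> \<delta> H \<subseteq> \<delta> G))"


section \<open>Laurent difference polynomials\<close>

text \<open>Exponents \<open>u(\<sigma>) \<in> \<int>[\<sigma>]\<^sup>n\<close> are vectors of integer polynomials in \<open>\<sigma>\<close>. The monomials
  \<open>x\<^bsup>u(\<sigma>)\<^esup>\<close> multiply by adding exponents, so the Laurent difference polynomial ring over \<open>K\<close>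
  is the monoid algebra of \<^typ>\<open>int poly ^ 'n\<close>; \<^term>\<open>Poly_Mapping.lookup f u\<close> is the coefficient of
  \<open>x\<^bsup>u(\<sigma>)\<^esup>\<close>.\<close>

type_synonym ('k, 'n) laurent_diff_poly = "(int poly ^ 'n) \<Rightarrow>\<^sub>0 'k"

definition exponent_at :: "real \<Rightarrow> int poly ^ 'n::finite \<Rightarrow> real ^ 'n" where
  "exponent_at \<rho> u = (\<chi> i. poly (map_poly of_int (u $ i)) \<rho>)"

definition trop_hypersurface ::
    "('k::field \<Rightarrow> real) \<Rightarrow> real \<Rightarrow> ('k, 'n::finite) laurent_diff_poly \<Rightarrow> (real ^ 'n) set" where
  "trop_hypersurface v \<rho> f =
     {w. let val = (\<lambda>u. v (Poly_Mapping.lookup f u) + exponent_at \<rho> u \<bullet> w)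
         in 2 \<le> card {u \<in> Poly_Mapping.keys f. \<forall>u'\<in>Poly_Mapping.keys f. val u \<le> val u'}}"

definition newton_polytope ::
    "real \<Rightarrow> ('k::zero, 'n) laurent_diff_poly \<Rightarrow> (real ^ 'n) set" where
  "newton_polytope \<rho> f = convex hull (exponent_at \<rho> ` Poly_Mapping.keys f)"

definition lifted_newton_polytope ::
    "('k::field \<Rightarrow> real) \<Rightarrow> real \<Rightarrow> ('k, 'n::finite) laurent_diff_poly \<Rightarrow> ((real ^ 'n) \<times> real) set" where
  "lifted_newton_polytope v \<rho> f =
     convex hull ((\<lambda>u. (exponent_at \<rho> u, v (Poly_Mapping.lookup f u))) ` Poly_Mapping.keys f)"

lemma fst_lifted_newton_polytope:
  "fst ` lifted_newton_polytope v \<rho> f = newton_polytope \<rho> f"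
  unfolding lifted_newton_polytope_def newton_polytope_def
  by (simp add: convex_hull_linear_image[OF linear_fst] image_image)

lemma Union_regular_subdivision:
  "\<Union>(regular_subdivision (lifted_newton_polytope v \<rho> f)) = newton_polytope \<rho> f"
proof (intro equalityI subsetI)
  fix x assume "x \<in> \<Union>(regular_subdivision (lifted_newton_polytope v \<rho> f))"
  then have "x \<in> fst ` lifted_newton_polytope v \<rho> f"
    unfolding regular_subdivision_def lower_faces_def min_face_def by blast
  then show "x \<in> newton_polytope \<rho> f"
    unfolding fst_lifted_newton_polytope .
next
  define P where "P = lifted_newton_polytope v \<rho> f"
  have "polytope P"
    unfolding P_def lifted_newton_polytope_def
    by (intro polytope_convex_hull finite_imageI Poly_Mapping.finite_keys)
  then have P: "compact P" "polyhedron P"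
    by (auto intro: polytope_imp_compact polytope_imp_polyhedron)
  fix x assume "x \<in> newton_polytope \<rho> f"
  then have "x \<in> fst ` P" unfolding P_def fst_lifted_newton_polytope .
  define Z where "Z = P \<inter> {z. fst z = x}"
  have "closed {z. fst z = x}" by (intro closed_Collect_eq continuous_intros)
  then have "compact Z" unfolding Z_def using P by (rule_tac compact_Int_closed)
  moreover have "Z \<noteq> {}" using \<open>x \<in> fst ` P\<close> unfolding Z_def by auto
  ultimately obtain z where z: "z \<in> Z" "\<And>y. y \<in> Z \<Longrightarrow> snd z \<le> snd y"
    using continuous_attains_inf[OF _ _ continuous_on_snd[OF continuous_on_id], of Z] by blast
  obtain H where H: "finite H" "P = \<Inter>H"
      and "\<forall>h\<in>H. \<exists>a b. a \<noteq> 0 \<and> h = {x. a \<bullet> x \<le> b}"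
    using P(2) unfolding polyhedron_def by blast
  then obtain a b where ab: "\<And>h. h \<in> H \<Longrightarrow> h = {x. a h \<bullet> x \<le> b h}"
    by metis
  have in_P: "y \<in> P \<longleftrightarrow> (\<forall>h\<in>H. a h \<bullet> y \<le> b h)" for y
    unfolding H(2) using ab by blast
  have zP: "z \<in> P" using z unfolding Z_def by blast
  have "\<exists>h\<in>H. a h \<bullet> z = b h \<and> snd (a h) < 0"
  proof (rule ccontr)
    assume no: "\<not> ?thesis"
    have "\<forall>h\<in>H. eventually (\<lambda>e. a h \<bullet> (z - (0, e)) \<le> b h) (at_right 0)"
    proof
      fix h assume h: "h \<in> H"
      have eq: "a h \<bullet> (z - (0, e)) = a h \<bullet> z - snd (a h) * e" for e
        by (simp add: inner_diff_right inner_prod_def algebra_simps)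
      have le: "a h \<bullet> z \<le> b h" using zP in_P h by blast
      show "eventually (\<lambda>e. a h \<bullet> (z - (0, e)) \<le> b h) (at_right 0)"
      proof (cases "snd (a h) < 0")
        case False
        then have "a h \<bullet> (z - (0, e)) \<le> b h" if "e > 0" for e
          unfolding eq using le that
          by (smt (verit) mult_nonneg_nonneg)
        then show ?thesis by (auto simp: eventually_at_filter)
      next
        case True
        with no h le have lt: "a h \<bullet> z < b h" by fastforce
        have "((\<lambda>e. a h \<bullet> z - snd (a h) * e) \<longlongrightarrow> a h \<bullet> z - snd (a h) * 0) (at_right 0)"
          by (intro tendsto_intros)
        then have "eventually (\<lambda>e. a h \<bullet> z - snd (a h) * e < b h) (at_right 0)"
          using lt by (intro order_tendstoD(2)) auto
        then show ?thesis unfolding eq by (rule eventually_mono) simp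
      qed
    qed
    then have "eventually (\<lambda>e. \<forall>h\<in>H. a h \<bullet> (z - (0, e)) \<le> b h) (at_right 0)"
      using H(1) by (simp add: eventually_ball_finite)
    moreover have "eventually (\<lambda>e::real. e > 0) (at_right 0)"
      by (rule eventually_at_right_less)
    ultimately have "eventually (\<lambda>e. e > 0 \<and> z - (0, e) \<in> P) (at_right 0)"
      by eventually_elim (simp add: in_P)
    then obtain e where "e > 0" "z - (0, e) \<in> P"
      using eventually_happens[of _ "at_right (0::real)"] trivial_limit_at_right_real by blast
    then have "z - (0, e) \<in> Z" using z(1) unfolding Z_def by simp
    with z(2)[OF this] \<open>e > 0\<close> show False by simp
  qed
  then obtain h where h: "h \<in> H" "a h \<bullet> z = b h" "snd (a h) < 0" by blast
  have "z \<in> min_face (- a h) P"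
    unfolding min_face_def using zP h in_P by auto
  moreover have "min_face (- a h) P \<in> lower_faces P"
    unfolding lower_faces_def using h by (intro CollectI exI[of _ "- a h"]) auto
  moreover have "fst z = x" using z(1) unfolding Z_def by simp
  ultimately show "x \<in> \<Union>(regular_subdivision (lifted_newton_polytope v \<rho> f))"
    unfolding P_def[symmetric] regular_subdivision_def by blast
qed

end

theory Submission
  imports Defs
begin

text \<open>Write \<open>S(w)\<close> for the set of exponents whose term attains the minimum at \<open>w\<close>. As \<open>\<rho>\<close> is
  transcendental, distinct exponents \<open>u(\<sigma>)\<close> have distinct values \<open>u(\<rho>)\<close>, so
  that \<open>S(w)\<close> can be identified with the set of points lifted into the lower face of \<open>P\<^sub>v\<^sub>a\<^sub>l\<close>
  selected by \<open>(w, 1)\<close>, and the cells of the dual complex are the sets \<open>{x. S(w) \<subseteq> S(x)}\<close>.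
  Since \<open>S\<close> can only shrink near a point, a cell is full-dimensional if and only if \<open>S(w)\<close> is a
  singleton; hence the other cells cover the tropical hypersurface. For purity, every \<open>S(w)\<close>
  with at least two elements contains one that is minimal among those with at least two elements.
  Rotating a supporting functional until a tie occurs shows that the points of such a minimal
  set lie on a line, which makes its cell open in a hyperplane.\<close>

section \<open>Exponents evaluated at a transcendental number\<close>

text \<open>A coordinate in which the exponents differ would yield a nonzero integer polynomial
  vanishing at \<open>\<rho>\<close>.\<close>

lemma exponent_at_eq_iff:
  assumes "\<not> algebraic \<rho>"
  shows "exponent_at \<rho> u = exponent_at \<rho> u' \<longleftrightarrow> u = u'"
proof
  assume eq: "exponent_at \<rho> u = exponent_at \<rho> u'"
  have "u $ i = u' $ i" for i
  proof (rule ccontr)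
    assume ne: "u $ i \<noteq> u' $ i"
    define q :: "real poly" where "q = map_poly of_int (u $ i - u' $ i)"
    have "q = map_poly of_int (u $ i) - map_poly of_int (u' $ i)"
      unfolding q_def by (intro poly_eqI) (simp add: coeff_map_poly)
    moreover have "exponent_at \<rho> u $ i = exponent_at \<rho> u' $ i" using eq by simp
    ultimately have "poly q \<rho> = 0" by (simp add: exponent_at_def)
    moreover have "q \<noteq> 0" using ne by (simp add: q_def map_poly_eq_0_iff)
    moreover have "Polynomial.coeff q i \<in> \<int>" for i by (simp add: q_def coeff_map_poly)
    ultimately show False using assms algebraicI[of q \<rho>] by blast
  qed
  then show "u = u'" by (simp add: vec_eq_iff)
qed simp

lemma Q_adjoin_add: "x \<in> Q_adjoin \<rho> \<Longrightarrow> y \<in> Q_adjoin \<rho> \<Longrightarrow> x + y \<in> Q_adjoin \<rho>"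
  using generate_field.eng_add[of x "ring_of_type_algebra :: real ring" "{\<rho>}" y]
  by (simp add: Q_adjoin_def ring_of_type_algebra_def)

lemma Q_adjoin_mult: "x \<in> Q_adjoin \<rho> \<Longrightarrow> y \<in> Q_adjoin \<rho> \<Longrightarrow> x * y \<in> Q_adjoin \<rho>"
  using generate_field.eng_mult[of x "ring_of_type_algebra :: real ring" "{\<rho>}" y]
  by (simp add: Q_adjoin_def ring_of_type_algebra_def)

lemma Q_adjoin_one: "1 \<in> Q_adjoin \<rho>"
  using generate_field.one[of "ring_of_type_algebra :: real ring" "{\<rho>}"]
  by (simp add: Q_adjoin_def ring_of_type_algebra_def)

lemma Q_adjoin_generator: "\<rho> \<in> Q_adjoin \<rho>"
  unfolding Q_adjoin_def by (simp add: generate_field.incl)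

lemma Q_adjoin_uminus:
  assumes "x \<in> Q_adjoin \<rho>" shows "- x \<in> Q_adjoin \<rho>"
proof -
  let ?R = "ring_of_type_algebra :: real ring"
  interpret ring ?R by rule
  \<comment> \<open>The inverse in the ring record is only characterised abstractly, so it has to be
    identified with real negation.\<close>
  have "x \<oplus>\<^bsub>?R\<^esub> (\<ominus>\<^bsub>?R\<^esub> x) = \<zero>\<^bsub>?R\<^esub>"
    by (rule r_neg) (simp add: ring_of_type_algebra_def)
  then have "\<ominus>\<^bsub>?R\<^esub> x = - x" by (simp add: ring_of_type_algebra_def)
  with generate_field.a_inv[of x ?R "{\<rho>}"] assms show ?thesis
    by (simp add: Q_adjoin_def)
qed

lemma Q_adjoin_diff: "x \<in> Q_adjoin \<rho> \<Longrightarrow> y \<in> Q_adjoin \<rho> \<Longrightarrow> x - y \<in> Q_adjoin \<rho>"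
  using Q_adjoin_add[of x \<rho> "- y"] Q_adjoin_uminus[of y \<rho>] by simp

lemma Q_adjoin_of_int: "of_int k \<in> Q_adjoin \<rho>"
proof (induction k rule: int_induct[of _ 0])
  case base
  show ?case using Q_adjoin_diff[OF Q_adjoin_one Q_adjoin_one] by simp
qed (auto intro: Q_adjoin_add Q_adjoin_diff Q_adjoin_one)

text \<open>Horner's scheme builds the value from integers and \<open>\<rho>\<close>. This makes the
  normals of the cells rational over the adjoined field.\<close>

lemma exponent_at_in_Q_adjoin: "exponent_at \<rho> u $ i \<in> Q_adjoin \<rho>"
proof -
  have "poly (map_poly of_int q) \<rho> \<in> Q_adjoin \<rho>" for q :: "int poly"
  proof (induction q)
    case 0
    show ?case using Q_adjoin_of_int[of 0] by simp
  next
    case (pCons a q)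
    then show ?case
      by (auto simp: map_poly_pCons intro!: Q_adjoin_add Q_adjoin_mult Q_adjoin_of_int Q_adjoin_generator)
  qed
  then show ?thesis by (simp add: exponent_at_def)
qed

section \<open>Lower faces and the regular subdivision\<close>

lemma min_face_scaleR: "0 < s \<Longrightarrow> min_face (s *\<^sub>R c) P = min_face c P"
  by (simp add: min_face_def)

text \<open>Positive rescaling of a functional keeps its face, so a positive last coordinate can be
  normalised to 1.\<close>

lemma lower_faces_eq: "lower_faces P = range (\<lambda>w. min_face (w, 1) P)"
proof (intro equalityI subsetI)
  fix F assume "F \<in> lower_faces P"
  then obtain c where c: "F = min_face c P" "0 < snd c" unfolding lower_faces_def by blast
  have "((1 / snd c) *\<^sub>R fst c, 1) = (1 / snd c) *\<^sub>R c" using c(2) by (simp add: prod_eq_iff)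
  moreover have "min_face ((1 / snd c) *\<^sub>R c) P = F"
    unfolding c(1) using c(2) by (intro min_face_scaleR) simp
  ultimately have "F = min_face ((1 / snd c) *\<^sub>R fst c, 1) P" by metis
  then show "F \<in> range (\<lambda>w. min_face (w, 1) P)" by blast
next
  fix F assume "F \<in> range (\<lambda>w. min_face (w, 1) P)"
  then show "F \<in> lower_faces P" unfolding lower_faces_def by fastforce
qed

text \<open>On a vertical line the functional \<open>(w, 1)\<close> compares last coordinates
  only.\<close>

lemma lower_faces_snd_le:
  assumes "F \<in> lower_faces P" "z \<in> F" "z' \<in> P" "fst z = fst z'"
  shows "snd z \<le> snd z'"
proof -
  obtain w where "F = min_face (w, 1) P" using assms(1) unfolding lower_faces_eq by blast
  with assms(2,3) have "(w, 1) \<bullet> z \<le> (w, 1) \<bullet> z'" unfolding min_face_def by blast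
  with assms(4) show ?thesis by (simp add: inner_prod_def)
qed

text \<open>Points of two lower faces over the same base point are both lowest in \<open>P\<close>,
  hence equal; projecting loses nothing.\<close>

lemma lower_faces_subset_iff:
  assumes "F \<in> lower_faces P" "G \<in> lower_faces P"
  shows "fst ` F \<subseteq> fst ` G \<longleftrightarrow> F \<subseteq> G"
proof
  assume sub: "fst ` F \<subseteq> fst ` G"
  have P: "F \<subseteq> P" "G \<subseteq> P" using assms unfolding lower_faces_def min_face_def by auto
  show "F \<subseteq> G"
  proof
    fix z assume z: "z \<in> F"
    with sub obtain z' where z': "z' \<in> G" "fst z = fst z'" by fastforce
    have "snd z \<le> snd z'" using lower_faces_snd_le[OF assms(1) z _ z'(2)] z'(1) P by blast
    moreover have "snd z' \<le> snd z"
      using lower_faces_snd_le[OF assms(2) z'(1) _ z'(2)[symmetric]] z P by blast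
    ultimately have "snd z = snd z'" by (rule antisym)
    with z'(2) have "z = z'" by (intro prod_eqI)
    with z'(1) show "z \<in> G" by simp
  qed
qed (rule image_mono)

text \<open>The functional selecting \<open>G\<close> lies in the dual cell of \<open>G\<close>, and
  testing at this one point recovers the inclusion.\<close>

lemma dual_cell_subset_iff:
  assumes "F \<in> lower_faces P" "G \<in> lower_faces P"
  shows "dual_cell P G \<subseteq> dual_cell P F \<longleftrightarrow> F \<subseteq> G"
proof
  assume sub: "dual_cell P G \<subseteq> dual_cell P F"
  obtain w where w: "G = min_face (w, 1) P" using assms(2) unfolding lower_faces_eq by blast
  then have "w \<in> dual_cell P G" by (simp add: dual_cell_def)
  with sub show "F \<subseteq> G" unfolding w dual_cell_def by blast
qed (auto simp: dual_cell_def)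

lemma dual_to_regular_subdivision_dual_complex:
  fixes P :: "('a::real_inner \<times> real) set"
  shows "dual_to_regular_subdivision (dual_complex P) P"
proof -
  \<comment> \<open>Comparing projections instead of faces avoids choosing a lower face over
    \<open>G\<close>.\<close>
  define \<delta> where "\<delta> G = {w. G \<subseteq> fst ` min_face (w, 1) P}" for G
  have \<delta>: "\<delta> (fst ` F) = dual_cell P F" if "F \<in> lower_faces P" for F
    unfolding \<delta>_def dual_cell_def
    using lower_faces_subset_iff[OF that] unfolding lower_faces_eq by blast
  have rev: "G \<subseteq> H \<longleftrightarrow> \<delta> H \<subseteq> \<delta> G"
    if "G \<in> regular_subdivision P" "H \<in> regular_subdivision P" for G H
  proof -
    from that obtain F F'
      where "F \<in> lower_faces P" "F' \<in> lower_faces P" "G = fst ` F" "H = fst ` F'"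
      unfolding regular_subdivision_def by blast
    then show ?thesis
      by (simp only: \<delta> dual_cell_subset_iff lower_faces_subset_iff)
  qed
  have "inj_on \<delta> (regular_subdivision P - {{}})"
    by (intro inj_onI) (metis DiffD1 rev subset_antisym subset_refl)
  moreover have "\<delta> ` (regular_subdivision P - {{}}) = dual_complex P - {{}}"
  proof -
    have ne: "dual_cell P F \<noteq> {}" if "F \<in> lower_faces P" for F
      using that unfolding lower_faces_eq dual_cell_def by blast
    have "regular_subdivision P - {{}} = (\<lambda>F. fst ` F) ` (lower_faces P - {{}})"
      unfolding regular_subdivision_def by auto
    then have "\<delta> ` (regular_subdivision P - {{}}) = dual_cell P ` (lower_faces P - {{}})"
      using \<delta> by (simp add: image_image)
    moreover have "{} \<notin> dual_cell P ` (lower_faces P - {{}})" using ne by fastforce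
    ultimately show ?thesis by (simp add: dual_complex_eq_dual_cells)
  qed
  ultimately have "bij_betw \<delta> (regular_subdivision P - {{}}) (dual_complex P - {{}})"
    by (simp add: bij_betw_def)
  with \<delta> rev show ?thesis unfolding dual_to_regular_subdivision_def by blast
qed

section \<open>Cells dual to a finite lifted point configuration\<close>

text \<open>Moving from \<open>P\<close> in the direction \<open>Q\<close>, the minimizer \<open>a\<close> stays minimal until the first tie.\<close>

lemma first_tie:
  fixes P Q :: "'i \<Rightarrow> real"
  assumes "finite A" "\<And>s. s \<in> A \<Longrightarrow> P a \<le> P s" "b \<in> A" "Q b < Q a"
  obtains t c where "0 \<le> t" "c \<in> A" "c \<noteq> a" "P c + t * Q c = P a + t * Q a"
    "\<And>s. s \<in> A \<Longrightarrow> P a + t * Q a \<le> P s + t * Q s"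
proof -
  \<comment> \<open>Only an index with smaller slope can undercut \<open>a\<close>. It meets
    \<open>a\<close> at time \<open>r s\<close>, and the earliest such time is the tie.\<close>
  define B where "B = {s \<in> A. Q s < Q a}"
  define r where "r s = (P s - P a) / (Q a - Q s)" for s
  have B: "finite B" "B \<noteq> {}" using assms by (auto simp: B_def)
  obtain c where c: "c \<in> B" "\<And>s. s \<in> B \<Longrightarrow> r c \<le> r s"
    using ex_is_arg_min_if_finite[OF B, of r] by (auto simp: is_arg_min_linorder)
  have rc: "0 \<le> r c" using c(1) assms(2) by (auto simp: r_def B_def)
  have tie: "P c + r c * Q c = P a + r c * Q a"
    using c(1) by (simp add: r_def B_def field_simps)
  have "P a + r c * Q a \<le> P s + r c * Q s" if s: "s \<in> A" for s
  proof (cases "Q s < Q a")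
    case True
    with s c(2) have "r c \<le> (P s - P a) / (Q a - Q s)" by (simp add: B_def r_def)
    with True show ?thesis by (simp add: field_simps)
  next
    case False
    then have "r c * Q a \<le> r c * Q s" using rc by (intro mult_left_mono) auto
    with assms(2)[OF s] show ?thesis by simp
  qed
  with rc c(1) tie show ?thesis by (intro that[of "r c" c]) (auto simp: B_def)
qed

lemma card_ge_2I: "finite A \<Longrightarrow> x \<in> A \<Longrightarrow> y \<in> A \<Longrightarrow> x \<noteq> y \<Longrightarrow> 2 \<le> card A"
  using card_mono[of A "{x, y}"] by auto

text \<open>\<open>I\<close> stands for the exponents of \<open>f\<close>, \<open>p\<close> for
  their values at \<open>\<rho>\<close>, \<open>h\<close> for the valuations of the coefficients.
  Injectivity of \<open>p\<close> is where transcendence enters.\<close>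

locale lifted_points =
  fixes I :: "'i set" and p :: "'i \<Rightarrow> 'a::euclidean_space" and h :: "'i \<Rightarrow> real"
  assumes finite_I: "finite I" and I_nonempty: "I \<noteq> {}" and inj_p: "inj_on p I"
begin

definition height :: "'i \<Rightarrow> 'a \<Rightarrow> real" where
  "height u w = h u + p u \<bullet> w"

definition active :: "'a \<Rightarrow> 'i set" where
  "active w = {u \<in> I. \<forall>u'\<in>I. height u w \<le> height u' w}"

text \<open>Indexing cells by points instead of index sets keeps them all nonempty.\<close>

definition cell :: "'a \<Rightarrow> 'a set" where
  "cell w = {x. active w \<subseteq> active x}"

definition lift :: "'i \<Rightarrow> 'a \<times> real" where
  "lift u = (p u, h u)"

lemma active_subset: "active w \<subseteq> I"
  by (auto simp: active_def)

lemma finite_active: "finite (active w)"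
  using active_subset finite_I by (rule finite_subset)

lemma active_nonempty: "active w \<noteq> {}"
  using ex_is_arg_min_if_finite[OF finite_I I_nonempty, of "\<lambda>u. height u w"]
  by (auto simp: is_arg_min_linorder active_def)

lemma active_eqD: "u \<in> active w \<Longrightarrow> u' \<in> active w \<Longrightarrow> height u w = height u' w"
  by (auto simp: active_def intro!: antisym)

lemma active_transfer: "a \<in> active w \<Longrightarrow> u \<in> I \<Longrightarrow> height u w \<le> height a w \<Longrightarrow> u \<in> active w"
  by (force simp: active_def)

lemma active_le: "a \<in> active w \<Longrightarrow> u \<in> I \<Longrightarrow> height a w \<le> height u w"
  by (simp add: active_def)

lemma mem_cell_self [simp]: "w \<in> cell w"
  by (simp add: cell_def)

lemma height_add_scaleR: "height u (w + e *\<^sub>R d) = height u w + e * (p u \<bullet> d)"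
  by (simp add: height_def inner_add_right)

section \<open>Cells as polyhedra and their local structure\<close>

lemma cell_eq_halfspaces:
  "cell w = (\<Inter>(s, u)\<in>active w \<times> I. {x. (p s - p u) \<bullet> x \<le> h u - h s})"
  using active_subset
  by (auto simp: cell_def active_def height_def inner_diff_left algebra_simps)

lemma polyhedron_cell: "polyhedron (cell w)"
  unfolding cell_eq_halfspaces using finite_active finite_I
  by (intro polyhedron_Inter) (auto simp: polyhedron_halfspace_le)

text \<open>Heights are affine, so the minimum at the midpoint is the mean of the two minima,
  reached only by indices minimal at both ends.\<close>

lemma active_midpoint:
  assumes "s \<in> active w" "s \<in> active w'"
  shows "active (midpoint w w') \<subseteq> active w \<inter> active w'"
proof
  fix u assume u: "u \<in> active (midpoint w w')"
  have mid: "2 * height i (midpoint w w') = height i w + height i w'" for i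
    by (simp add: height_def midpoint_def inner_add_right algebra_simps)
  have sI: "s \<in> I" "u \<in> I" using assms u active_subset by auto
  have "height u (midpoint w w') \<le> height s (midpoint w w')" using active_le[OF u sI(1)] .
  with mid[of u] mid[of s] active_le[OF assms(1) sI(2)] active_le[OF assms(2) sI(2)]
  have "height u w \<le> height s w" "height u w' \<le> height s w'" by linarith+
  with assms sI(2) show "u \<in> active w \<inter> active w'" by (auto intro: active_transfer)
qed

text \<open>Each inactive index is strictly above a fixed active one, and finitely many strict
  inequalities between continuous functions persist nearby.\<close>

lemma eventually_active_subset: "eventually (\<lambda>y. active y \<subseteq> active w) (nhds w)"
proof -
  obtain a where a: "a \<in> active w" using active_nonempty by blast
  have "eventually (\<lambda>y. height a y < height u y) (nhds w)" if "u \<in> I - active w" for u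
  proof (rule eventually_nhds_in_open[of "{y. height a y < height u y}", simplified])
    show "open {y. height a y < height u y}"
      unfolding height_def by (intro open_Collect_less continuous_intros)
    show "height a w < height u w" using that a active_transfer[OF a, of u] by force
  qed
  then have "eventually (\<lambda>y. \<forall>u\<in>I - active w. height a y < height u y) (nhds w)"
    using finite_I by (intro eventually_ball_finite) auto
  then show ?thesis
  proof eventually_elim
    case (elim y)
    have aI: "a \<in> I" using a active_subset by blast
    show ?case
    proof
      fix u assume u: "u \<in> active y"
      then have uI: "u \<in> I" using active_subset by blast
      from active_le[OF u aI] have "\<not> height a y < height u y" by simp
      with uI elim show "u \<in> active w" by blast
    qed
  qed
qed

lemma active_subset_along:
  obtains e where "0 < e" "active (w + e *\<^sub>R d) \<subseteq> active w"
proof -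
  have "((\<lambda>e. w + e *\<^sub>R d) \<longlongrightarrow> w + 0 *\<^sub>R d) (at_right 0)" by (intro tendsto_intros)
  then have "filterlim (\<lambda>e. w + e *\<^sub>R d) (nhds w) (at_right 0)" by simp
  from eventually_compose_filterlim[OF eventually_active_subset this]
  have "eventually (\<lambda>e. 0 < e \<and> active (w + e *\<^sub>R d) \<subseteq> active w) (at_right 0)"
    using eventually_at_right_less[of "0::real"] by eventually_elim simp
  then show thesis
    using eventually_happens[of _ "at_right (0::real)"] trivial_limit_at_right_real that by blast
qed

text \<open>When no new index becomes active at \<open>y\<close>, minimality there need only be
  tested against the indices active at \<open>w\<close>.\<close>

lemma mem_active_of_ties:
  assumes "active y \<subseteq> active w" "u \<in> active w"
    and "\<And>s. s \<in> active w \<Longrightarrow> height u y \<le> height s y"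
  shows "u \<in> active y"
proof -
  obtain a where "a \<in> active y" using active_nonempty by blast
  with assms active_subset show ?thesis by (blast intro: active_transfer)
qed

text \<open>The indices active at \<open>w\<close> stay tied along the line through \<open>x\<close>
  and \<open>w\<close>, so the segment extends past \<open>w\<close>: a point is relatively interior
  to its own cell.\<close>

lemma cell_prolongation:
  assumes "x \<in> cell w"
  obtains e where "0 < e" "w + e *\<^sub>R (w - x) \<in> cell w"
proof -
  obtain e where e: "0 < e" "active (w + e *\<^sub>R (w - x)) \<subseteq> active w"
    by (rule active_subset_along)
  have "u \<in> active (w + e *\<^sub>R (w - x))" if u: "u \<in> active w" for u
  proof (rule mem_active_of_ties[OF e(2) u])
    fix s assume s: "s \<in> active w"
    have "height u w = height s w" "height u x = height s x"
      using u s assms by (auto simp: cell_def intro: active_eqD)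
    then have "p u \<bullet> (w - x) = p s \<bullet> (w - x)" by (simp add: height_def inner_diff_right)
    with \<open>height u w = height s w\<close>
    show "height u (w + e *\<^sub>R (w - x)) \<le> height s (w + e *\<^sub>R (w - x))"
      by (simp add: height_add_scaleR)
  qed
  with e(1) show thesis by (intro that) (auto simp: cell_def)
qed

text \<open>A nonempty face is the cell of any of its points with fewest active indices.\<close>

lemma face_of_cell:
  assumes "is_face F (cell w)" "F \<noteq> {}"
  shows "F \<in> range cell"
proof -
  obtain c where F: "F = min_face c (cell w)" using assms unfolding is_face_def by blast
  have F_cell: "F \<subseteq> cell w" by (auto simp: F min_face_def)
  have "convex F"
    using is_face_iff_face_of[OF polyhedron_cell] assms(1) face_of_imp_convex by blast
  obtain s where s: "s \<in> active w" using active_nonempty by blast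
  obtain y where y: "y \<in> F" "\<And>x. x \<in> F \<Longrightarrow> card (active y) \<le> card (active x)"
    using assms(2) ex_has_least_nat[of "\<lambda>x. x \<in> F" _ "\<lambda>x. card (active x)"] by blast
  have "F = cell y"
  proof (intro equalityI subsetI)
    fix x assume x: "x \<in> F"
    have "s \<in> active y" "s \<in> active x" using s x y F_cell by (auto simp: cell_def)
    then have sub: "active (midpoint y x) \<subseteq> active y \<inter> active x" by (rule active_midpoint)
    have "midpoint y x \<in> closed_segment y x" by (simp add: midpoint_in_closed_segment)
    then have "midpoint y x \<in> F"
      using \<open>convex F\<close> x y(1) closed_segment_subset by blast
    \<comment> \<open>By the choice of \<open>y\<close> the midpoint cannot have fewer active
      indices than \<open>y\<close>.\<close>
    then have "active (midpoint y x) = active y"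
      using y(2) sub finite_active by (intro card_seteq) auto
    with sub show "x \<in> cell y" by (auto simp: cell_def)
  next
    fix x assume x: "x \<in> cell y"
    then obtain e where e: "0 < e" "y + e *\<^sub>R (y - x) \<in> cell y" by (rule cell_prolongation)
    have "cell y \<subseteq> cell w" using y(1) F_cell by (auto simp: cell_def)
    with e x have xw: "x \<in> cell w" "y + e *\<^sub>R (y - x) \<in> cell w" by auto
    \<comment> \<open>The prolonged point lies beyond \<open>y\<close> as seen from
      \<open>x\<close>. Since \<open>c\<close> does not decrease there, its value at
      \<open>x\<close> is at most that at \<open>y\<close>.\<close>
    then have "c \<bullet> y \<le> c \<bullet> (y + e *\<^sub>R (y - x))" using y(1) by (auto simp: F min_face_def)
    with e(1) have "c \<bullet> x \<le> c \<bullet> y"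
      by (simp add: inner_add_right inner_diff_right zero_le_mult_iff)
    moreover have "\<forall>z\<in>cell w. c \<bullet> y \<le> c \<bullet> z" using y(1) by (auto simp: F min_face_def)
    ultimately show "x \<in> F" using xw(1) by (force simp: F min_face_def)
  qed
  then show ?thesis by blast
qed

text \<open>On \<open>cell w\<close>, the excess over \<open>s\<close> summed over the indices
  active at \<open>y\<close> is affine and nonnegative, and vanishes exactly on
  \<open>cell y\<close>. Its linear part \<open>c\<close> exposes the intersection.\<close>

lemma is_face_cell_Int: "is_face (cell w \<inter> cell y) (cell w)"
proof (cases "cell w \<inter> cell y = {}")
  case False
  then obtain z where z: "z \<in> cell w" "z \<in> cell y" by blast
  obtain s where s: "s \<in> active w" using active_nonempty by blast
  define c where "c = (\<Sum>u\<in>active y. p u - p s)"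
  define g where "g x = (\<Sum>u\<in>active y. height u x - height s x)" for x
  define k where "k = (\<Sum>u\<in>active y. h u - h s)"
  have g: "g x = k + c \<bullet> x" for x
    unfolding g_def c_def k_def height_def inner_sum_left
    by (simp add: inner_diff_left algebra_simps flip: sum.distrib)
  have s_active: "s \<in> active x" if "x \<in> cell w" for x using s that by (auto simp: cell_def)
  have nonneg: "0 \<le> height u x - height s x" if "x \<in> cell w" "u \<in> active y" for x u
    using active_le[OF s_active[OF that(1)], of u] that(2) active_subset by auto
  have zero: "g x = 0 \<longleftrightarrow> x \<in> cell y" if x: "x \<in> cell w" for x
  proof -
    have "g x = 0 \<longleftrightarrow> (\<forall>u\<in>active y. height u x - height s x = 0)"
      unfolding g_def using finite_active nonneg[OF x] by (intro sum_nonneg_eq_0_iff) auto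
    also have "\<dots> \<longleftrightarrow> x \<in> cell y"
      using s_active[OF x] active_subset[of y] unfolding cell_def
      by (auto dest: active_eqD intro: active_transfer)
    finally show ?thesis .
  qed
  have pos: "0 \<le> g x" if "x \<in> cell w" for x
    unfolding g_def by (intro sum_nonneg nonneg that)
  have "min_face c (cell w) = cell w \<inter> cell y"
  proof (intro equalityI subsetI)
    fix x assume "x \<in> min_face c (cell w)"
    then have x: "x \<in> cell w" "g x \<le> g z" using z by (auto simp: min_face_def g)
    with zero[OF z(1)] z(2) pos[OF x(1)] have "g x = 0" by simp
    with zero x(1) show "x \<in> cell w \<inter> cell y" by blast
  next
    fix x assume x: "x \<in> cell w \<inter> cell y"
    then have "g x = 0" using zero by blast
    with pos have "\<forall>x'\<in>cell w. g x \<le> g x'" by simp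
    with x show "x \<in> min_face c (cell w)" by (simp add: min_face_def g)
  qed
  then show ?thesis unfolding is_face_def by blast
qed (simp add: is_face_def)

lemma polyhedral_complex_cells: "polyhedral_complex (insert {} (range cell))"
  unfolding polyhedral_complex_def
proof (intro conjI ballI allI impI)
  \<comment> \<open>A cell depends only on its active set, a subset of the finite set
    \<open>I\<close>.\<close>
  have "range cell \<subseteq> (\<lambda>S. {x. S \<subseteq> active x}) ` Pow I"
    using active_subset by (auto simp: cell_def)
  then have "finite (range cell)" by (rule finite_subset) (simp add: finite_I)
  then show "finite (insert {} (range cell))" by simp
next
  fix C F assume "C \<in> insert {} (range cell)" "is_face F C"
  then show "F \<in> insert {} (range cell)"
    using face_of_cell by (auto simp: is_face_def min_face_def)
next
  fix C D assume "C \<in> insert {} (range cell)" "D \<in> insert {} (range cell)"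
  then consider "C \<inter> D = {}" | w y where "C = cell w" "D = cell y" by auto
  then show "is_face (C \<inter> D) C" "is_face (C \<inter> D) D"
    using is_face_cell_Int by (cases, simp add: is_face_def, metis Int_commute)+
qed (auto intro: polyhedron_cell)

section \<open>Identification with the dual complex of the lifted polytope\<close>

lemma inner_lift: "(w, 1) \<bullet> lift u = height u w"
  by (simp add: lift_def height_def inner_prod_def inner_commute)

lemma lift_in_min_face_iff:
  assumes "u \<in> I"
  shows "lift u \<in> min_face (w, 1) (convex hull (lift ` I)) \<longleftrightarrow> u \<in> active w"
proof
  assume "u \<in> active w"
  then have "lift ` I \<subseteq> {x. (w, 1) \<bullet> lift u \<le> (w, 1) \<bullet> x}"
    by (auto simp: inner_lift active_def)
  moreover have "convex {x. (w, 1) \<bullet> lift u \<le> (w, 1) \<bullet> x}"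
    using convex_halfspace_ge[of "(w, 1) \<bullet> lift u" "(w, 1)"] by simp
  ultimately have "convex hull (lift ` I) \<subseteq> {x. (w, 1) \<bullet> lift u \<le> (w, 1) \<bullet> x}"
    by (rule hull_minimal)
  with assms show "lift u \<in> min_face (w, 1) (convex hull (lift ` I))"
    by (auto simp: min_face_def hull_inc)
next
  assume "lift u \<in> min_face (w, 1) (convex hull (lift ` I))"
  then have "\<forall>u'\<in>I. (w, 1) \<bullet> lift u \<le> (w, 1) \<bullet> lift u'"
    by (auto simp: min_face_def hull_inc)
  with assms show "u \<in> active w" by (simp add: active_def inner_lift)
qed

text \<open>A face of the hull of a finite set is the hull of some generators, and the generators on
  this face are the active ones.\<close>

lemma min_face_eq_hull_active:
  "min_face (w, 1) (convex hull (lift ` I)) = convex hull (lift ` active w)"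
proof
  let ?P = "convex hull (lift ` I)" and ?F = "min_face (w, 1) (convex hull (lift ` I))"
  have "polyhedron ?P"
    using finite_I by (intro polytope_imp_polyhedron polytope_convex_hull) auto
  then have face: "?F face_of ?P"
    using is_face_iff_face_of unfolding is_face_def by blast
  have "compact (lift ` I)" using finite_I by (simp add: finite_imp_compact)
  then obtain S where S: "S \<subseteq> lift ` I" "?F = convex hull S"
    using face_of_convex_hull_subset[OF _ face] by blast
  then have "S \<subseteq> ?F" by (simp add: hull_subset)
  with S(1) have "S \<subseteq> lift ` active w" using lift_in_min_face_iff by blast
  then show "?F \<subseteq> convex hull (lift ` active w)" unfolding S(2) by (rule hull_mono)
  have "lift ` active w \<subseteq> ?F" using active_subset lift_in_min_face_iff by blast
  then show "convex hull (lift ` active w) \<subseteq> ?F"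
    using face face_of_imp_convex by (intro hull_minimal) auto
qed

lemma dual_cell_min_face:
  "dual_cell (convex hull (lift ` I)) (min_face (w, 1) (convex hull (lift ` I))) = cell w"
proof -
  have "min_face (w, 1) (convex hull (lift ` I)) \<subseteq> min_face (x, 1) (convex hull (lift ` I))
    \<longleftrightarrow> active w \<subseteq> active x" for x
  proof
    assume "active w \<subseteq> active x"
    then show "min_face (w, 1) (convex hull (lift ` I)) \<subseteq> min_face (x, 1) (convex hull (lift ` I))"
      unfolding min_face_eq_hull_active by (intro hull_mono image_mono)
  qed (use active_subset lift_in_min_face_iff in blast)
  then show ?thesis by (simp add: dual_cell_def cell_def)
qed

lemma dual_complex_eq_cells: "dual_complex (convex hull (lift ` I)) = insert {} (range cell)"
proof -
  \<comment> \<open>Some index is always active, so no lower face is empty.\<close>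
  have "lower_faces (convex hull (lift ` I)) - {{}} = range (\<lambda>w. min_face (w, 1) (convex hull (lift ` I)))"
    using active_nonempty by (auto simp: lower_faces_eq min_face_eq_hull_active)
  then show ?thesis
    unfolding dual_complex_eq_dual_cells by (simp add: image_image dual_cell_min_face)
qed

section \<open>Dimensions of cells\<close>

text \<open>Two indices active at \<open>w\<close> tie on the whole cell, confining it to a
  hyperplane whose normal is nonzero by injectivity of \<open>p\<close>.\<close>

lemma aff_dim_cell_le:
  assumes "2 \<le> card (active w)"
  shows "aff_dim (cell w) \<le> int DIM('a) - 1"
proof -
  obtain a b where ab: "a \<in> active w" "b \<in> active w" "a \<noteq> b"
    using assms card_le_Suc0_iff_eq[OF finite_active[of w]] by force
  then have "p a - p b \<noteq> 0" using inj_p active_subset by (force dest: inj_onD)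
  have "height a x = height b x" if "x \<in> cell w" for x
    using that ab by (auto simp: cell_def intro: active_eqD)
  then have "cell w \<subseteq> {x. (p a - p b) \<bullet> x = h b - h a}"
    by (auto simp: height_def inner_diff_left algebra_simps)
  then have "aff_dim (cell w) \<le> aff_dim {x. (p a - p b) \<bullet> x = h b - h a}" by (rule aff_dim_subset)
  with \<open>p a - p b \<noteq> 0\<close> show ?thesis by (simp add: aff_dim_hyperplane)
qed

text \<open>Near \<open>w\<close> the ties on \<open>H\<close> make all of \<open>active w\<close>
  active, so the cell contains a neighbourhood of \<open>w\<close> in \<open>H\<close>.\<close>

lemma aff_dim_cell_ge:
  assumes "convex H" "w \<in> H"
    and ties: "\<And>x u s. x \<in> H \<Longrightarrow> u \<in> active w \<Longrightarrow> s \<in> active w \<Longrightarrow> height u x = height s x"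
  shows "aff_dim H \<le> aff_dim (cell w)"
proof -
  obtain U where U: "open U" "w \<in> U" "\<And>x. x \<in> U \<Longrightarrow> active x \<subseteq> active w"
    using eventually_active_subset[of w] unfolding eventually_nhds by blast
  have "H \<inter> U \<subseteq> cell w"
  proof
    fix x assume x: "x \<in> H \<inter> U"
    have "u \<in> active x" if "u \<in> active w" for u
      using mem_active_of_ties[of x w u] U(3)[of x] ties[of x u] x that by auto
    then show "x \<in> cell w" by (auto simp: cell_def)
  qed
  then have "aff_dim (H \<inter> U) \<le> aff_dim (cell w)" by (rule aff_dim_subset)
  with assms U show ?thesis using aff_dim_convex_Int_open[of H U] by force
qed

lemma aff_dim_cell_le_iff: "aff_dim (cell w) \<le> int DIM('a) - 1 \<longleftrightarrow> 2 \<le> card (active w)"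
proof
  assume le: "aff_dim (cell w) \<le> int DIM('a) - 1"
  show "2 \<le> card (active w)"
  proof (rule ccontr)
    assume "\<not> 2 \<le> card (active w)"
    then have "card (active w) \<le> Suc 0" by simp
    then have "u = s" if "u \<in> active w" "s \<in> active w" for u s
      using that card_le_Suc0_iff_eq[OF finite_active] by blast
    \<comment> \<open>For a single active index the ties are vacuous, so the whole space serves as
      \<open>H\<close>.\<close>
    then have "aff_dim (UNIV :: 'a set) \<le> aff_dim (cell w)"
      by (intro aff_dim_cell_ge) auto
    with le show False by (simp add: aff_dim_UNIV)
  qed
qed (rule aff_dim_cell_le)

section \<open>The skeleton of codimension one\<close>

lemma mem_skeleton_iff:
  "C \<in> skeleton (int DIM('a) - 1) (insert {} (range cell)) \<longleftrightarrow>
    C = {} \<or> (\<exists>w. C = cell w \<and> 2 \<le> card (active w))"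
proof -
  have "aff_dim ({} :: 'a set) \<le> int DIM('a) - 1" by simp
  then show ?thesis unfolding skeleton_def using aff_dim_cell_le_iff by blast
qed

lemma Union_skeleton:
  "\<Union>(skeleton (int DIM('a) - 1) (insert {} (range cell))) = {w. 2 \<le> card (active w)}"
proof (intro equalityI subsetI)
  fix x assume "x \<in> \<Union>(skeleton (int DIM('a) - 1) (insert {} (range cell)))"
  then obtain C where "C \<in> skeleton (int DIM('a) - 1) (insert {} (range cell))" "x \<in> C"
    by (rule UnionE)
  then obtain w where w: "x \<in> cell w" "2 \<le> card (active w)"
    unfolding mem_skeleton_iff by blast
  then have "card (active w) \<le> card (active x)"
    by (intro card_mono finite_active) (simp add: cell_def)
  with w(2) show "x \<in> {w. 2 \<le> card (active w)}" by simp
next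
  fix w assume "w \<in> {w. 2 \<le> card (active w)}"
  then have "cell w \<in> skeleton (int DIM('a) - 1) (insert {} (range cell))"
    unfolding mem_skeleton_iff by blast
  then show "w \<in> \<Union>(skeleton (int DIM('a) - 1) (insert {} (range cell)))"
    by (rule UnionI) simp
qed

section \<open>Purity and dimension of the skeleton\<close>

text \<open>Moving from the origin in direction \<open>p a - p b\<close>, the height of
  \<open>b\<close> grows more slowly than that of \<open>a\<close>, which forces a first
  tie.\<close>

lemma ex_ge_2_active:
  assumes "2 \<le> card I"
  obtains w where "2 \<le> card (active w)"
proof -
  obtain a where a: "a \<in> active 0" using active_nonempty by blast
  then have aI: "a \<in> I" using active_subset by blast
  have "\<not> (\<forall>x\<in>I. \<forall>y\<in>I. x = y)" using assms card_le_Suc0_iff_eq[OF finite_I] by simp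
  then obtain b where b: "b \<in> I" "b \<noteq> a" using aI by metis
  then have "p b \<noteq> p a" using inj_p aI by (auto dest: inj_onD)
  then have "0 < (p a - p b) \<bullet> (p a - p b)" by simp
  then have lt: "p b \<bullet> (p a - p b) < p a \<bullet> (p a - p b)"
    by (simp only: inner_diff_left)
  have le: "h a \<le> h s" if "s \<in> I" for s using active_le[OF a that] by (simp add: height_def)
  obtain t c where "0 \<le> t" and tc: "c \<in> I" "c \<noteq> a"
      "h c + t * (p c \<bullet> (p a - p b)) = h a + t * (p a \<bullet> (p a - p b))"
      "\<And>s. s \<in> I \<Longrightarrow> h a + t * (p a \<bullet> (p a - p b)) \<le> h s + t * (p s \<bullet> (p a - p b))"
    by (rule first_tie[of I h a b "\<lambda>u. p u \<bullet> (p a - p b)", OF finite_I le b(1) lt])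
      (assumption | rule that)+
  then have "a \<in> active (t *\<^sub>R (p a - p b))" "c \<in> active (t *\<^sub>R (p a - p b))"
    using aI by (auto simp: active_def height_def)
  with tc(2) show thesis by (intro that card_ge_2I[OF finite_active])
qed

text \<open>The bounding functional is \<open>- p a\<close> for a point \<open>p a\<close> of largest norm: it is uniquely minimal
  at \<open>p a\<close>. Rotating it towards \<open>d\<close> until the first tie and moving \<open>w\<close> slightly in the resulting
  direction keeps at least two indices active, hence by minimality all of them.\<close>

lemma minimal_active_collinear:
  assumes card: "2 \<le> card (active w)"
    and minimal: "\<And>y. active y \<subseteq> active w \<Longrightarrow> 2 \<le> card (active y) \<Longrightarrow> active y = active w"
  obtains a b where "a \<in> active w" "b \<in> active w" "a \<noteq> b"
    "\<And>d s. (p b - p a) \<bullet> d = 0 \<Longrightarrow> s \<in> active w \<Longrightarrow> (p s - p a) \<bullet> d = 0"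
proof -
  obtain a where a: "a \<in> active w" "\<And>s. s \<in> active w \<Longrightarrow> norm (p s) \<le> norm (p a)"
    using ex_is_arg_min_if_finite[OF finite_active active_nonempty, of "\<lambda>s. - norm (p s)" w]
    by (auto simp: is_arg_min_linorder)
  have "\<not> (\<forall>x\<in>active w. \<forall>y\<in>active w. x = y)"
    using card card_le_Suc0_iff_eq[OF finite_active[of w]] by simp
  then obtain b where b: "b \<in> active w" "b \<noteq> a" using a(1) by metis
  \<comment> \<open>If the right side is zero then \<open>p s = p a\<close>; this gives the
    contradiction below.\<close>
  have max: "(norm (p s - p a))\<^sup>2 \<le> 2 * (p a \<bullet> p a - p a \<bullet> p s)" if "s \<in> active w" for s
  proof -
    have "(norm (p s))\<^sup>2 \<le> (norm (p a))\<^sup>2" using a(2)[OF that] by (intro power_mono) auto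
    then show ?thesis
      by (simp add: power2_norm_eq_inner inner_diff_left inner_diff_right inner_commute)
  qed
  have nonneg: "0 \<le> (p s - p a) \<bullet> d"
    if d: "(p b - p a) \<bullet> d = 0" and s: "s \<in> active w" for d s
  proof (rule ccontr)
    assume "\<not> 0 \<le> (p s - p a) \<bullet> d"
    then have lt: "p s \<bullet> d < p a \<bullet> d" by (simp add: inner_diff_left)
    have le: "- (p a \<bullet> p a) \<le> - (p a \<bullet> p u)" if "u \<in> active w" for u
      using order_trans[OF zero_le_power2 max[OF that]] by simp
    obtain t c where "0 \<le> t" and tc: "c \<in> active w" "c \<noteq> a"
        "- (p a \<bullet> p c) + t * (p c \<bullet> d) = - (p a \<bullet> p a) + t * (p a \<bullet> d)"
        "\<And>u. u \<in> active w \<Longrightarrow>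
          - (p a \<bullet> p a) + t * (p a \<bullet> d) \<le> - (p a \<bullet> p u) + t * (p u \<bullet> d)"
      by (rule first_tie[of "active w" "\<lambda>u. - (p a \<bullet> p u)" a s "\<lambda>u. p u \<bullet> d",
          OF finite_active le s lt])
        (assumption | rule that)+
    define q where "q = t *\<^sub>R d - p a"
    have q: "p u \<bullet> q = - (p a \<bullet> p u) + t * (p u \<bullet> d)" for u
      by (simp add: q_def inner_diff_right inner_commute)
    obtain e where e: "0 < e" "active (w + e *\<^sub>R q) \<subseteq> active w" by (rule active_subset_along)
    have mem: "u \<in> active (w + e *\<^sub>R q)" if u: "u \<in> active w" "p u \<bullet> q = p a \<bullet> q" for u
    proof (rule mem_active_of_ties[OF e(2) u(1)])
      fix i assume i: "i \<in> active w"
      have "p u \<bullet> q \<le> p i \<bullet> q" using tc(4)[OF i] u(2) by (simp add: q)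
      then have "e * (p u \<bullet> q) \<le> e * (p i \<bullet> q)" using e(1) by simp
      then show "height u (w + e *\<^sub>R q) \<le> height i (w + e *\<^sub>R q)"
        using active_eqD[OF u(1) i] by (simp add: height_add_scaleR)
    qed
    have "a \<in> active (w + e *\<^sub>R q)" "c \<in> active (w + e *\<^sub>R q)"
      using mem[OF a(1)] mem[OF tc(1)] tc(3) by (simp_all add: q)
    then have "active (w + e *\<^sub>R q) = active w"
      using e(2) tc(2) by (intro minimal card_ge_2I[OF finite_active])
    then have "height b (w + e *\<^sub>R q) = height a (w + e *\<^sub>R q)"
      using a(1) b(1) by (intro active_eqD) auto
    then have "p b \<bullet> q = p a \<bullet> q"
      using e(1) active_eqD[OF b(1) a(1)] by (simp add: height_add_scaleR)
    moreover have "p b \<bullet> d = p a \<bullet> d" using d by (simp add: inner_diff_left)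
    ultimately have "p a \<bullet> p b = p a \<bullet> p a" by (simp add: q)
    with max[OF b(1)] have "p b = p a" by simp
    with b a(1) inj_p active_subset show False by (blast dest: inj_onD)
  qed
  \<comment> \<open>The orthogonality condition is symmetric in \<open>d\<close>, so nonnegativity
    applies to \<open>d\<close> and \<open>- d\<close>.\<close>
  have "(p s - p a) \<bullet> d = 0" if "(p b - p a) \<bullet> d = 0" "s \<in> active w" for d s
    using nonneg[of d s] nonneg[of "- d" s] that by simp
  with a(1) b show thesis by (intro that[of a b]) auto
qed

text \<open>A smallest active set inside \<open>active w\<close> with at least two indices has
  collinear points, so its ties persist on the hyperplane \<open>H\<close> through \<open>y\<close>
  orthogonal to their line. Fewer active indices mean a larger cell, which therefore contains
  \<open>cell w\<close>.\<close>

lemma ex_maximal_cell: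
  assumes "2 \<le> card (active w)"
  obtains y where "2 \<le> card (active y)" "is_face (cell w) (cell y)"
    "aff_dim (cell y) = int DIM('a) - 1"
proof -
  obtain y where y: "active y \<subseteq> active w" "2 \<le> card (active y)"
    and least: "\<And>z. active z \<subseteq> active w \<Longrightarrow> 2 \<le> card (active z) \<Longrightarrow> card (active y) \<le> card (active z)"
    using assms ex_has_least_nat[of "\<lambda>y. active y \<subseteq> active w \<and> 2 \<le> card (active y)" w "\<lambda>y. card (active y)"]
    by blast
  have "active z = active y" if "active z \<subseteq> active y" "2 \<le> card (active z)" for z
    using least[of z] that y(1) finite_active by (intro card_seteq) auto
  then obtain a b where ab: "a \<in> active y" "b \<in> active y" "a \<noteq> b"
    "\<And>d s. (p b - p a) \<bullet> d = 0 \<Longrightarrow> s \<in> active y \<Longrightarrow> (p s - p a) \<bullet> d = 0"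
    using minimal_active_collinear[OF y(2)] by blast
  define H where "H = {x. (p b - p a) \<bullet> x = (p b - p a) \<bullet> y}"
  have "p b - p a \<noteq> 0" using ab inj_p active_subset by (force dest: inj_onD)
  then have H: "aff_dim H = int DIM('a) - 1" unfolding H_def by (simp add: aff_dim_hyperplane)
  have "aff_dim H \<le> aff_dim (cell y)"
  proof (rule aff_dim_cell_ge)
    have tie_a: "height u x = height a x" if "x \<in> H" "u \<in> active y" for x u
    proof -
      have "(p b - p a) \<bullet> (x - y) = 0" using that(1) by (simp add: H_def inner_diff_right)
      from ab(4)[OF this that(2)] active_eqD[OF that(2) ab(1)] show ?thesis
        by (simp add: height_def inner_diff_left inner_diff_right)
    qed
    then show "height u x = height s x" if "x \<in> H" "u \<in> active y" "s \<in> active y" for x u s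
      using that by simp
  qed (auto simp: H_def convex_hyperplane)
  then have "aff_dim (cell y) = int DIM('a) - 1"
    using H aff_dim_cell_le[OF y(2)] by simp
  moreover have "is_face (cell w) (cell y)"
  proof -
    have "cell y \<inter> cell w = cell w" using y(1) by (auto simp: cell_def)
    then show ?thesis using is_face_cell_Int[of y w] by simp
  qed
  ultimately show thesis using y(2) that by blast
qed

lemma skeleton_in_maximal_cell:
  assumes "2 \<le> card I" "C \<in> skeleton (int DIM('a) - 1) (insert {} (range cell))"
  obtains D where "D \<in> skeleton (int DIM('a) - 1) (insert {} (range cell))" "is_face C D"
    "aff_dim D = int DIM('a) - 1"
proof -
  \<comment> \<open>The empty cell is a face of every cell, so for it any \<open>w\<close> with a
    tie will do.\<close>
  obtain w where w: "2 \<le> card (active w)" "C = {} \<or> C = cell w"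
    using assms(2) ex_ge_2_active[OF assms(1)] unfolding mem_skeleton_iff by metis
  obtain y where "2 \<le> card (active y)" "is_face (cell w) (cell y)"
    "aff_dim (cell y) = int DIM('a) - 1"
    using ex_maximal_cell[OF w(1)] by blast
  moreover from this w(2) have "is_face C (cell y)" by (auto simp: is_face_def)
  ultimately show thesis using that[of "cell y"] unfolding mem_skeleton_iff by blast
qed

lemma skeleton_trivial:
  assumes "\<not> 2 \<le> card I"
  shows "skeleton (int DIM('a) - 1) (insert {} (range cell)) = {{}}"
proof -
  have "\<not> 2 \<le> card (active w)" for w
    using assms card_mono[OF finite_I active_subset[of w]] by simp
  then show ?thesis using mem_skeleton_iff by blast
qed

text \<open>A facet is a face of a cell of top dimension, so a smaller dimension would contradict
  maximality. With a single index only the empty cell remains.\<close>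

lemma pure_skeleton: "pure_complex (skeleton (int DIM('a) - 1) (insert {} (range cell)))"
proof (cases "2 \<le> card I")
  case True
  have "aff_dim C = int DIM('a) - 1"
    if "complex_facet C (skeleton (int DIM('a) - 1) (insert {} (range cell)))" for C
  proof -
    from that have C: "C \<in> skeleton (int DIM('a) - 1) (insert {} (range cell))"
      by (simp add: complex_facet_def)
    then have "aff_dim C \<le> int DIM('a) - 1" by (simp add: skeleton_def)
    moreover obtain D where "D \<in> skeleton (int DIM('a) - 1) (insert {} (range cell))"
      "is_face C D" "aff_dim D = int DIM('a) - 1"
      using skeleton_in_maximal_cell[OF True C] by blast
    ultimately show ?thesis using that unfolding complex_facet_def by force
  qed
  then show ?thesis by (simp add: pure_complex_def)
next
  case False
  then show ?thesis by (simp add: skeleton_trivial pure_complex_def complex_facet_def)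
qed

lemma complex_dim_skeleton:
  assumes "2 \<le> card I"
  shows "complex_dim (skeleton (int DIM('a) - 1) (insert {} (range cell))) = int DIM('a) - 1"
proof -
  let ?T = "skeleton (int DIM('a) - 1) (insert {} (range cell))"
  have "{} \<in> ?T" by (simp add: mem_skeleton_iff)
  then obtain D where D: "D \<in> ?T" "aff_dim D = int DIM('a) - 1"
    using skeleton_in_maximal_cell[OF assms] by blast
  have "finite ?T"
    using polyhedral_complex_cells unfolding polyhedral_complex_def skeleton_def by simp
  then have "finite (aff_dim ` ?T)" by simp
  moreover have "d \<le> int DIM('a) - 1" if "d \<in> aff_dim ` ?T" for d
    using that by (auto simp: skeleton_def)
  moreover have "int DIM('a) - 1 \<in> aff_dim ` ?T"
    using D by (simp only: image_eqI[of "int DIM('a) - 1" aff_dim D])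
  ultimately show ?thesis unfolding complex_dim_def by (rule Max_eqI)
qed

end

section \<open>Skeleta of polyhedral complexes\<close>

text \<open>Faces never exceed the dimension of their cell, so they survive the cut.\<close>

lemma polyhedral_complex_skeleton:
  assumes "polyhedral_complex \<C>"
  shows "polyhedral_complex (skeleton d \<C>)"
proof -
  have "aff_dim F \<le> aff_dim C" if "is_face F C" for F C :: "'a set"
    using that by (intro aff_dim_subset) (auto simp: is_face_def min_face_def)
  then show ?thesis
    using assms unfolding polyhedral_complex_def skeleton_def by (auto intro: order_trans)
qed

text \<open>Renumbers a finite system of inequalities by an initial segment of the naturals, as the
  definition demands.\<close>

lemma rational_polyhedron_finite_halfspaces:
  fixes A :: "'i \<Rightarrow> real ^ 'n" and B :: "'i \<Rightarrow> real"
  assumes "finite J" "\<And>i. i \<in> J \<Longrightarrow> B i \<in> G" "\<And>i j. i \<in> J \<Longrightarrow> A i $ j \<in> Q"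
  shows "rational_polyhedron G Q (\<Inter>i\<in>J. {x. A i \<bullet> x \<le> B i})"
proof -
  obtain e where e: "bij_betw e {0..<card J} J" using ex_bij_betw_nat_finite[OF assms(1)] by blast
  then have J: "J = e ` {..<card J}" by (auto simp: bij_betw_def atLeast0LessThan)
  then have "(\<Inter>i\<in>J. {x. A i \<bullet> x \<le> B i}) = {x. \<forall>k<card J. A (e k) \<bullet> x \<le> B (e k)}"
    by (auto, metis imageE lessThan_iff)
  moreover have "e k \<in> J" if "k < card J" for k using J that by blast
  ultimately show ?thesis
    unfolding rational_polyhedron_def using assms(2,3)
    by (intro exI[of _ "card J"] exI[of _ "\<lambda>k. A (e k)"] exI[of _ "\<lambda>k. B (e k)"]) auto
qed

lemma rational_polyhedron_cell:
  fixes p :: "'i \<Rightarrow> real ^ 'n"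
  assumes "lifted_points I p"
    and G: "\<And>u u'. u \<in> I \<Longrightarrow> u' \<in> I \<Longrightarrow> h u - h u' \<in> G"
    and Q: "\<And>u u' j. u \<in> I \<Longrightarrow> u' \<in> I \<Longrightarrow> p u $ j - p u' $ j \<in> Q"
  shows "rational_polyhedron G Q (lifted_points.cell I p h w)"
proof -
  interpret lifted_points I p h by fact
  have "cell w = (\<Inter>i\<in>active w \<times> I. {x. (p (fst i) - p (snd i)) \<bullet> x \<le> h (snd i) - h (fst i)})"
    unfolding cell_eq_halfspaces by auto
  also have "rational_polyhedron G Q \<dots>"
    using finite_active finite_I subsetD[OF active_subset] G Q
    by (intro rational_polyhedron_finite_halfspaces) auto
  finally show ?thesis .
qed

lemma real_submodule_diff: "real_submodule R G \<Longrightarrow> x \<in> G \<Longrightarrow> y \<in> G \<Longrightarrow> x - y \<in> G"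
  by (simp add: real_submodule_def)

text \<open>With fewer than two terms the skeleton is just the empty cell, of dimension -1; hence
  the guard on the last conjunct.\<close>

theorem proposition1p4:
  fixes v :: "'k::field_char_0 \<Rightarrow> real"
    and \<sigma> :: "'k \<Rightarrow> 'k"
    and \<rho> :: real
    and t :: "real \<Rightarrow> 'k"
    and f :: "('k, 'n::finite) laurent_diff_poly"
  assumes "valued_difference_field v \<sigma>"
    and "spherically_complete v"
    and "ACFA (residue_field v) (residue_automorphism \<sigma>)"
    and "ring_char_zero (residue_field v)"
    and "multiplicative_scaling v \<sigma> \<rho>"
    and "\<not> algebraic \<rho>"
    and "real_submodule (Q_adjoin \<rho>) (value_group v)"
    and "compatible_splitting v \<sigma> \<rho> t"
  shows "let n = int CARD('n);
             P_val = lifted_newton_polytope v \<rho> f;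
             D = dual_complex P_val;
             T = skeleton (n - 1) D
         in polyhedral_complex D \<and> dual_to_regular_subdivision D P_val \<and>
            trop_hypersurface v \<rho> f = \<Union>T \<and>
            rational_polyhedral_complex (value_group v) (Q_adjoin \<rho>) T \<and>
            pure_complex T \<and>
            (2 \<le> card (Poly_Mapping.keys f) \<longrightarrow> complex_dim T = n - 1)"
proof -
  define I where "I = Poly_Mapping.keys f"
  define p where "p = (exponent_at \<rho> :: int poly ^ 'n \<Rightarrow> real ^ 'n)"
  define h where "h u = v (Poly_Mapping.lookup f u)" for u
  define P where "P = lifted_newton_polytope v \<rho> f"
  define T where "T = skeleton (int CARD('n) - 1) (dual_complex P)"
  have P: "P = convex hull ((\<lambda>u. (p u, h u)) ` I)"
    unfolding P_def lifted_newton_polytope_def I_def p_def h_def ..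
  have "polyhedral_complex (dual_complex P) \<and> trop_hypersurface v \<rho> f = \<Union>T \<and>
    (\<forall>C\<in>T. C \<noteq> {} \<longrightarrow> rational_polyhedron (value_group v) (Q_adjoin \<rho>) C) \<and>
    pure_complex T \<and> (2 \<le> card I \<longrightarrow> complex_dim T = int CARD('n) - 1)"
  \<comment> \<open>The locale needs a nonempty configuration, so \<open>f = 0\<close> is treated
    apart: its polytope is empty and its dual complex has only the empty cell.\<close>
  proof (cases "I = {}")
    case True
    then have "P = {}" by (simp add: P)
    then have "dual_complex P = {{}}"
      by (auto simp: dual_complex_eq_dual_cells lower_faces_def min_face_def)
    moreover from this have "T = {{}}" by (simp add: T_def skeleton_def Collect_conv_if)
    moreover have "trop_hypersurface v \<rho> f = {}"
      using True by (simp add: trop_hypersurface_def I_def)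
    ultimately show ?thesis
      using True
      by (auto simp: polyhedral_complex_def pure_complex_def complex_facet_def is_face_def min_face_def)
  next
    case False
    interpret lifted_points I p h
      using False assms(6)
      by unfold_locales (auto simp: I_def p_def exponent_at_eq_iff intro!: inj_onI)
    have D: "dual_complex P = insert {} (range cell)"
      using dual_complex_eq_cells unfolding P lift_def[abs_def] .
    have T: "T = skeleton (int DIM(real ^ 'n) - 1) (insert {} (range cell))"
      by (simp add: T_def D)
    have "trop_hypersurface v \<rho> f = {w. 2 \<le> card (active w)}"
      unfolding trop_hypersurface_def Let_def active_def height_def
      unfolding I_def p_def h_def ..
    then have trop: "trop_hypersurface v \<rho> f = \<Union>T" by (simp only: T Union_skeleton)
    have rational: "rational_polyhedron (value_group v) (Q_adjoin \<rho>) (cell w)" for w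
    proof (rule rational_polyhedron_cell[OF lifted_points_axioms])
      \<comment> \<open>Keys carry nonzero coefficients, so the arbitrary value of \<open>v\<close>
        at zero never enters.\<close>
      have "h u \<in> value_group v" if "u \<in> I" for u
        using that by (auto simp: h_def I_def value_group_def in_keys_iff)
      then show "h u - h u' \<in> value_group v" if "u \<in> I" "u' \<in> I" for u u'
        using that assms(7) real_submodule_diff by blast
      show "p u $ j - p u' $ j \<in> Q_adjoin \<rho>" for u u' j
        unfolding p_def by (intro Q_adjoin_diff exponent_at_in_Q_adjoin)
    qed
    have "\<forall>C\<in>T. C \<noteq> {} \<longrightarrow> rational_polyhedron (value_group v) (Q_adjoin \<rho>) C"
    proof (intro ballI impI)
      fix C assume "C \<in> T" "C \<noteq> {}"
      then obtain w where "C = cell w" unfolding T mem_skeleton_iff by blast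
      with rational show "rational_polyhedron (value_group v) (Q_adjoin \<rho>) C" by simp
    qed
    with trop show ?thesis
      using polyhedral_complex_cells pure_skeleton complex_dim_skeleton unfolding T D by simp
  qed
  then have "polyhedral_complex (dual_complex P) \<and> dual_to_regular_subdivision (dual_complex P) P \<and>
    trop_hypersurface v \<rho> f = \<Union>T \<and>
    rational_polyhedral_complex (value_group v) (Q_adjoin \<rho>) T \<and>
    pure_complex T \<and> (2 \<le> card I \<longrightarrow> complex_dim T = int CARD('n) - 1)"
    using polyhedral_complex_skeleton[of "dual_complex P" "int CARD('n) - 1"]
    by (simp add: rational_polyhedral_complex_def dual_to_regular_subdivision_dual_complex flip: T_def)
  then show ?thesis
    unfolding Let_def T_def P_def I_def .
qed

end
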